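(* Let $D$ be an integrally closed domain which is not a field, with quotient field $K$, let $\overline{K}$ be an algebraic closure of $K$, and let $\overline{D}$ be the integral closure of $D$ in $\overline{K}$. Let $A$ be a $D$-algebra which is torsion-free and finitely generated as a $D$-module, and let $S$ be a finite subset of $A$. Let $\Omega_S\subset\overline{D}$ be the set of all roots in $\overline{D}$ of the minimal polynomials $\mu_s(X)$ of $s$, as $s$ ranges through $S$. Then the integral closure of $\mathrm{Int}_K(S,A)$ (in its quotient field $K(X)$) is $\mathrm{Int}_K(\Omega_S,\overline{D})$.
   Context: The algebra $A$ is associative with unit, possibly non-commutative and possibly with zero-divisors. Elements of $A$ are viewed in the extended $K$-algebra $B=A\otimes_D K$, into which $A$ and $K$ embed, and polynomials of $K[X]$ are evaluated at elements of $A$ inside $B$. For $s\in A$, the minimal polynomial $\mu_s(X)$ is the monic generator of the ideal of $K[X]$ of polynomials vanishing at $s$ (not necessarily irreducible); since $s$ is integral over $D$ and $D$ is integrally closed, $\mu_s\in D[X]$. Define $\mathrm{Int}_K(S,A)=\{f\in K[X] : f(s)\in A\text{ for all }s\in S\}$, and, for $\Omega\subseteq\overline{K}$, $\mathrm{Int}_K(\Omega,\overline{D})=\{f\in K[X] : f(\alpha)\in\overline{D}\text{ for all }\alpha\in\Omega\}$. *)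

theory Defs
  imports
    "HOL-Computational_Algebra.Computational_Algebra"
    "HOL-Library.Poly_Mapping"
    "HOL-Algebra.QuotRing"
    "HOL-Algebra.Generated_Groups"
begin

section \<open>Integral closure\<close>

definition integral_over :: "'r::comm_ring_1 set \<Rightarrow> 'r \<Rightarrow> bool" where
  "integral_over R x \<longleftrightarrow>
     (\<exists>p :: 'r poly. lead_coeff p = 1 \<and> (\<forall>i. coeff p i \<in> R) \<and> poly p x = 0)"

definition integral_closure :: "'r::comm_ring_1 set \<Rightarrow> 'r set" where
  "integral_closure R = {x. integral_over R x}"

definition quotient_field_of :: "'k::field set \<Rightarrow> 'k set" where
  "quotient_field_of R = {a / b | a b. a \<in> R \<and> b \<in> R \<and> b \<noteq> 0}"

definition integrally_closed_domain :: "'d::idom itself \<Rightarrow> bool" where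
  "integrally_closed_domain _ \<longleftrightarrow>
     integral_closure (range (to_fract :: 'd \<Rightarrow> 'd fract)) = range to_fract"

text \<open>\<open>\<iota>\<close> exhibits the algebraically closed field \<open>'l\<close> as an algebraic closure of \<open>'k\<close>.\<close>

definition algebraic_closure_embedding :: "('k::field \<Rightarrow> 'l::alg_closed_field) \<Rightarrow> bool" where
  "algebraic_closure_embedding \<iota> \<longleftrightarrow>
     \<iota> 1 = 1 \<and> (\<forall>x y. \<iota> (x + y) = \<iota> x + \<iota> y) \<and> (\<forall>x y. \<iota> (x * y) = \<iota> x * \<iota> y) \<and>
     (\<forall>z. \<exists>p. p \<noteq> 0 \<and> poly (map_poly \<iota> p) z = 0)"


section \<open>Torsion-free, finitely generated algebras\<close>

locale associative_algebra = Modules.module scale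
  for scale :: "'d::comm_ring_1 \<Rightarrow> 'a::ring_1 \<Rightarrow> 'a" +
  assumes scale_mult_left: "scale d x * y = scale d (x * y)"
    and scale_mult_right: "x * scale d y = scale d (x * y)"

definition torsion_free :: "('d::idom \<Rightarrow> 'a::ring_1 \<Rightarrow> 'a) \<Rightarrow> bool" where
  "torsion_free scale \<longleftrightarrow> (\<forall>d x. scale d x = 0 \<longrightarrow> d = 0 \<or> x = 0)"

definition finitely_generated :: "('d::idom \<Rightarrow> 'a::ring_1 \<Rightarrow> 'a) \<Rightarrow> bool" where
  "finitely_generated scale \<longleftrightarrow> (\<exists>T. finite T \<and> module.span scale T = UNIV)"


section \<open>The extended algebra \<open>B = A \<otimes>\<^sub>D K\<close>\<close>

text \<open>
  The free abelian group on \<open>A \<times> K\<close> with the bilinear product determined by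
  \<open>(a, k) (a', k') = (a a', k k')\<close>. The product that \<^typ>\<open>'i \<Rightarrow>\<^sub>0 'c\<close> carries in the library
  is the convolution for the \<^emph>\<open>addition\<close> of \<open>'i\<close>, hence not the one needed here.
\<close>

definition free_mult ::
  "('a::ring_1 \<times> 'k::field \<Rightarrow>\<^sub>0 int) \<Rightarrow> ('a \<times> 'k \<Rightarrow>\<^sub>0 int) \<Rightarrow> ('a \<times> 'k \<Rightarrow>\<^sub>0 int)" where
  "free_mult u v =
     (\<Sum>p\<in>Poly_Mapping.keys u. \<Sum>q\<in>Poly_Mapping.keys v.
        Poly_Mapping.single (fst p * fst q, snd p * snd q)
          (Poly_Mapping.lookup u p * Poly_Mapping.lookup v q))"

definition free_ring :: "('a::ring_1 \<times> 'k::field \<Rightarrow>\<^sub>0 int) ring" where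
  "free_ring = \<lparr>carrier = UNIV, mult = free_mult, one = Poly_Mapping.single (1, 1) 1,
                zero = 0, add = (+)\<rparr>"

definition tensor_relations ::
  "('d::idom \<Rightarrow> 'a::ring_1 \<Rightarrow> 'a) \<Rightarrow> ('a \<times> 'd fract \<Rightarrow>\<^sub>0 int) set" where
  "tensor_relations scale =
     (let e = (\<lambda>a k. Poly_Mapping.single (a, k) 1) in
        {e (a + b) k - e a k - e b k | a b k. True}
      \<union> {e a (k + l) - e a k - e a l | a k l. True}
      \<union> {e (scale d a) k - e a (to_fract d * k) | d a k. True})"

definition tensor_null ::
  "('d::idom \<Rightarrow> 'a::ring_1 \<Rightarrow> 'a) \<Rightarrow> ('a \<times> 'd fract \<Rightarrow>\<^sub>0 int) set" where
  "tensor_null scale = generate (add_monoid free_ring) (tensor_relations scale)"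

definition tensor_ring ::
  "('d::idom \<Rightarrow> 'a::ring_1 \<Rightarrow> 'a) \<Rightarrow> ('a \<times> 'd fract \<Rightarrow>\<^sub>0 int) set ring" where
  "tensor_ring scale = free_ring Quot tensor_null scale"

definition tensor ::
  "('d::idom \<Rightarrow> 'a::ring_1 \<Rightarrow> 'a) \<Rightarrow> 'a \<Rightarrow> 'd fract \<Rightarrow> ('a \<times> 'd fract \<Rightarrow>\<^sub>0 int) set" where
  "tensor scale a k = tensor_null scale +>\<^bsub>free_ring\<^esub> Poly_Mapping.single (a, k) 1"

text \<open>\<open>f(s)\<close> computed in \<open>B\<close>, with \<open>A\<close> and \<open>K\<close> embedded by \<open>a \<mapsto> a \<otimes> 1\<close> and \<open>k \<mapsto> 1 \<otimes> k\<close>.\<close>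

definition tensor_eval ::
  "('d::idom \<Rightarrow> 'a::ring_1 \<Rightarrow> 'a) \<Rightarrow> 'd fract poly \<Rightarrow> 'a \<Rightarrow> ('a \<times> 'd fract \<Rightarrow>\<^sub>0 int) set" where
  "tensor_eval scale f s =
     (\<Oplus>\<^bsub>tensor_ring scale\<^esub>i\<in>{..degree f}.
        tensor scale 1 (coeff f i) \<otimes>\<^bsub>tensor_ring scale\<^esub>
          (tensor scale s 1 [^]\<^bsub>tensor_ring scale\<^esub> i))"


section \<open>Minimal polynomials and integer-valued polynomials\<close>

definition minimal_poly :: "('d::idom \<Rightarrow> 'a::ring_1 \<Rightarrow> 'a) \<Rightarrow> 'a \<Rightarrow> 'd fract poly" where
  "minimal_poly scale s =
     (THE m. lead_coeff m = 1 \<and>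
        {f. tensor_eval scale f s = \<zero>\<^bsub>tensor_ring scale\<^esub>} = {f. m dvd f})"

definition Int_alg :: "('d::idom \<Rightarrow> 'a::ring_1 \<Rightarrow> 'a) \<Rightarrow> 'a set \<Rightarrow> 'd fract poly set" where
  "Int_alg scale S = {f. \<forall>s\<in>S. \<exists>a. tensor_eval scale f s = tensor scale a 1}"

text \<open>\<open>\<iota> : K \<rightarrow> L\<close> is the chosen algebraic closure of \<open>K\<close>.\<close>

definition D_bar :: "('d::idom fract \<Rightarrow> 'l::field) \<Rightarrow> 'l set" where
  "D_bar \<iota> = integral_closure (range (\<lambda>d. \<iota> (to_fract d)))"

definition Int_bar :: "('d::idom fract \<Rightarrow> 'l::field) \<Rightarrow> 'l set \<Rightarrow> 'd fract poly set" where
  "Int_bar \<iota> \<Omega> = {f. \<forall>\<alpha>\<in>\<Omega>. poly (map_poly \<iota> f) \<alpha> \<in> D_bar \<iota>}"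

definition root_set ::
  "('d::idom \<Rightarrow> 'a::ring_1 \<Rightarrow> 'a) \<Rightarrow> ('d fract \<Rightarrow> 'l::field) \<Rightarrow> 'a set \<Rightarrow> 'l set" where
  "root_set scale \<iota> S =
     {\<alpha> \<in> D_bar \<iota>. \<exists>s\<in>S. poly (map_poly \<iota> (minimal_poly scale s)) \<alpha> = 0}"

end

theory Submission
  imports Defs "Jordan_Normal_Form.Char_Poly"
begin

text \<open>
  Write \<open>f(s)\<close> for the value in \<open>B = A \<otimes>\<^sub>D K\<close> of a polynomial \<open>f\<close> over \<open>K\<close>. Everything rests on two
  facts: every element of \<open>A\<close> is integral over \<open>D\<close> (\<open>every_element_integral\<close>, an instance of the
  determinant trick), and \<open>f(s) = 0\<close> means that \<open>\<mu>\<^sub>s\<close> divides \<open>f\<close>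
  (\<open>value_at_0_iff_minimal_poly_dvd\<close>).

  If \<open>f\<close> is integer-valued on \<open>S\<close>, then \<open>a = f(s)\<close> is a root of some monic \<open>h\<close> over \<open>D\<close>, hence \<open>\<mu>\<^sub>s\<close>
  divides \<open>h \<circ> f\<close> and \<open>h(f(\<alpha>)) = 0\<close> for every root \<open>\<alpha>\<close> of \<open>\<mu>\<^sub>s\<close>. So \<open>f\<close> maps \<open>\<Omega>\<^sub>S\<close> into the integral
  closure of \<open>D\<close> (\<open>Int_alg_subset_Int_bar\<close>). The ring of polynomials with the latter property is
  integrally closed in \<open>K(X)\<close> (\<open>integral_over_Int_bar\<close>): an element of \<open>K(X)\<close> integral over it is
  a polynomial, since \<open>K[X]\<close> is integrally closed, and evaluating an equation of integral
  dependence at \<open>\<alpha> \<in> \<Omega>\<^sub>S\<close> exhibits its value at \<open>\<alpha>\<close> as integral over the integral closure of \<open>D\<close>,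
  hence over \<open>D\<close> by transitivity (\<open>integral_element_trans\<close>).

  Conversely, let \<open>f\<close> map \<open>\<Omega>\<^sub>S\<close> into the integral closure of \<open>D\<close>
  (\<open>Int_bar_integral_over_Int_alg\<close>). Since \<open>\<Omega>\<^sub>S\<close> is finite, a
  single monic polynomial \<open>H\<close> over \<open>D\<close> vanishes at all \<open>f(\<alpha>)\<close>, so \<open>H \<circ> f\<close> vanishes at all roots of
  every \<open>\<mu>\<^sub>s\<close>. A power of \<open>H\<close>, say \<open>Q\<close>, accounts for the multiplicities: \<open>\<mu>\<^sub>s\<close> divides \<open>G = Q \<circ> f\<close>
  for all \<open>s \<in> S\<close>. Thus \<open>G\<close> and all its multiples vanish on \<open>S\<close> and are in particular integer-valued
  on \<open>S\<close>, and \<open>f\<close> is a root of the monic polynomial \<open>Y Q(Y) - f G\<close>, whose coefficients are integer-valued.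

  To reason about \<open>B\<close> only once, the condition \<open>f(s) = a\<close> with \<open>a\<close> in \<open>A\<close> is translated into
  \<open>D\<close>-polynomials (\<open>value_at\<close>): some nonzero \<open>d\<close> satisfies \<open>d f = g \<in> D[X]\<close> and \<open>g(s) = d a\<close>. That this
  is equivalent is the injectivity of \<open>A \<rightarrow> B\<close> for torsion-free \<open>A\<close>.
\<close>

section \<open>Evaluation in an algebra and the determinant trick\<close>

(* The name smult denotes the scaling of polynomials, not that of the modules of abstract algebra. *)
hide_const (open) Module.smult

context associative_algebra
begin

definition eval_poly :: "'d poly \<Rightarrow> 'a \<Rightarrow> 'a" where
  "eval_poly p x = fold_coeffs (\<lambda>c y. scale c 1 + x * y) p 0"

lemma eval_poly_0 [simp]: "eval_poly 0 x = 0"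
  by (simp add: eval_poly_def)

lemma eval_poly_pCons [simp]: "eval_poly (pCons c p) x = scale c 1 + x * eval_poly p x"
  by (cases "p = 0 \<and> c = 0") (auto simp: eval_poly_def)

lemma eval_poly_add: "eval_poly (p + q) x = eval_poly p x + eval_poly q x"
proof (induction p arbitrary: q)
  case (pCons c p)
  then show ?case by (cases q) (simp add: scale_left_distrib algebra_simps)
qed simp

lemma eval_poly_smult: "eval_poly (smult c p) x = scale c (eval_poly p x)"
  by (induction p) (simp_all add: scale_right_distrib scale_mult_right)

lemma eval_poly_mult: "eval_poly (p * q) x = eval_poly p x * eval_poly q x"
  by (induction p)
    (simp_all add: eval_poly_add eval_poly_smult algebra_simps scale_mult_left)

lemma eval_poly_sum: "eval_poly (sum f I) x = (\<Sum>i\<in>I. eval_poly (f i) x)"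
  by (induction I rule: infinite_finite_induct) (simp_all add: eval_poly_add)

lemma eval_poly_eq_sum:
  "eval_poly p x = (\<Sum>i\<le>degree p. scale (coeff p i) (x ^ i))"
proof (induction p)
  case (pCons c p)
  show ?case
  proof (cases "p = 0")
    case False
    have "(\<Sum>i\<le>degree (pCons c p). scale (coeff (pCons c p) i) (x ^ i))
        = scale c 1 + (\<Sum>i\<le>degree p. scale (coeff p i) (x * x ^ i))"
      using False by (simp add: sum.atMost_Suc_shift del: sum.atMost_Suc)
    then show ?thesis
      by (simp add: pCons.IH sum_distrib_left scale_mult_right)
  qed simp
qed simp

text \<open>
  A finitely generated submodule stable under multiplication by \<open>s\<close> makes \<open>s\<close> integral. If
  \<open>s v\<^sub>i = \<Sum>\<^sub>j c\<^sub>i\<^sub>j v\<^sub>j\<close>, the matrix \<open>M = X I - C\<close> over \<open>D[X]\<close>, acting through \<open>X \<mapsto> s\<close>, annihilates the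
  vector \<open>v\<close>. Multiplying by its adjugate shows that \<open>det M\<close>, which is the monic characteristic
  polynomial of \<open>C\<close>, annihilates every \<open>v\<^sub>i\<close>, hence also \<open>1\<close>. Letting the polynomials act by left
  multiplication turns the possibly noncommutative algebra into a module over \<open>D[X]\<close>.
\<close>

lemma determinant_trick:
  assumes fin: "finite T" and one: "1 \<in> span T"
    and stable: "\<And>t. t \<in> T \<Longrightarrow> s * t \<in> span T"
  obtains h where "lead_coeff h = 1" "eval_poly h s = 0"
proof -
  define n where "n = card T"
  obtain v where v: "bij_betw v {..<n} T"
    using ex_bij_betw_nat_finite[OF fin] by (auto simp: n_def atLeast0LessThan)
  have span_T: "\<exists>u. x = (\<Sum>j<n. scale (u j) (v j))" if "x \<in> span T" for x
  proof -
    obtain u where "x = (\<Sum>t\<in>T. scale (u t) t)"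
      using \<open>x \<in> span T\<close> by (auto simp: span_finite[OF fin])
    also have "\<dots> = (\<Sum>j<n. scale (u (v j)) (v j))"
      using v by (rule sum.reindex_bij_betw[symmetric])
    finally show ?thesis by (rule exI[of _ "\<lambda>j. u (v j)"])
  qed
  have "\<forall>i<n. \<exists>u. s * v i = (\<Sum>j<n. scale (u j) (v j))"
    using v by (auto intro!: span_T stable dest: bij_betwE)
  then obtain c where c: "\<And>i. i < n \<Longrightarrow> s * v i = (\<Sum>j<n. scale (c i j) (v j))"
    by metis
  define C where "C = mat n n (\<lambda>(i, j). c i j)"
  define M where "M = char_poly_matrix C"
  have C: "C \<in> carrier_mat n n" by (simp add: C_def)
  then have M: "M \<in> carrier_mat n n" by (simp add: M_def)
  have M_entry: "M $$ (i, j) = (if i = j then [:0, 1:] else 0) + [:- c i j:]" if "i < n" "j < n" for i j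
    using that C by (simp add: M_def char_poly_matrix_def C_def)
  have row: "(\<Sum>j<n. eval_poly (M $$ (i, j)) s * v j) = 0" if "i < n" for i
  proof -
    have "(\<Sum>j<n. eval_poly (M $$ (i, j)) s * v j)
        = (\<Sum>j<n. (if i = j then s * v j else 0) - scale (c i j) (v j))"
      using that
      by (intro sum.cong) (auto simp: M_entry eval_poly_add algebra_simps scale_mult_left)
    also have "\<dots> = 0"
      using that by (simp add: sum_subtractf c)
    finally show ?thesis .
  qed
  have det_kills: "eval_poly (det M) s * v k = 0" if "k < n" for k
  proof -
    let ?B = "adj_mat M"
    have B: "?B \<in> carrier_mat n n" using M by (rule adj_mat)
    have "(\<Sum>i<n. ?B $$ (k, i) * M $$ (i, j)) = (if k = j then det M else 0)" if "j < n" for j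
    proof -
      have "(?B * M) $$ (k, j) = (\<Sum>i<n. ?B $$ (k, i) * M $$ (i, j))"
        using B M \<open>k < n\<close> \<open>j < n\<close>
        by (simp add: times_mat_def scalar_prod_def atLeast0LessThan)
      then show ?thesis
        using adj_mat(3)[OF M] \<open>k < n\<close> \<open>j < n\<close> by (simp split: if_splits)
    qed
    then have "eval_poly (det M) s * v k
        = (\<Sum>j<n. eval_poly (\<Sum>i<n. ?B $$ (k, i) * M $$ (i, j)) s * v j)"
      using that by (simp add: if_distrib[of "\<lambda>p. eval_poly p s * _"] cong: if_cong)
    also have "\<dots> = (\<Sum>j<n. \<Sum>i<n. eval_poly (?B $$ (k, i)) s * (eval_poly (M $$ (i, j)) s * v j))"
      by (simp add: eval_poly_sum eval_poly_mult sum_distrib_right mult.assoc)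
    also have "\<dots> = (\<Sum>i<n. eval_poly (?B $$ (k, i)) s * (\<Sum>j<n. eval_poly (M $$ (i, j)) s * v j))"
      by (subst sum.swap) (simp add: sum_distrib_left)
    also have "\<dots> = 0"
      by (simp add: row)
    finally show ?thesis .
  qed
  \<comment> \<open>The unit is a combination of the generators, so the determinant annihilates it too.\<close>
  obtain u where u: "1 = (\<Sum>j<n. scale (u j) (v j))"
    using span_T[OF one] by blast
  have "eval_poly (det M) s * 1 = (\<Sum>j<n. scale (u j) (eval_poly (det M) s * v j))"
    by (subst u) (simp add: sum_distrib_left scale_mult_right)
  then have "eval_poly (det M) s = 0"
    by (simp add: det_kills)
  moreover have "lead_coeff (det M) = 1"
    using degree_monic_char_poly[OF C] by (simp add: M_def char_poly_def)
  ultimately show thesis by (rule that[rotated])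
qed

end

section \<open>Transitivity of integral dependence\<close>

lemma monic_root_power_degree:
  fixes p :: "'r::comm_ring_1 poly"
  assumes "lead_coeff p = 1" "poly p x = 0"
  shows "x ^ degree p = - (\<Sum>i<degree p. coeff p i * x ^ i)"
  using assms by (simp add: poly_altdef lessThan_Suc_atMost[symmetric] eq_neg_iff_add_eq_0 add.commute)

context associative_algebra
begin

definition integral_element :: "'a \<Rightarrow> bool" where
  "integral_element x \<longleftrightarrow> (\<exists>h. lead_coeff h = 1 \<and> eval_poly h x = 0)"

lemma finite_span_integral_element:
  assumes "finite T" "span T = UNIV"
  shows "integral_element x"
  using determinant_trick[of T x] assms by (auto simp: integral_element_def)

end

locale commutative_algebra = associative_algebra scale
  for scale :: "'d::comm_ring_1 \<Rightarrow> 'a::comm_ring_1 \<Rightarrow> 'a"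
begin

text \<open>
  Elements stabilising the submodule generated by \<open>T\<close>. When that submodule is finitely generated
  and contains \<open>1\<close>, all of them are integral by the determinant trick; adjoining integral elements one
  after the other only enlarges the submodule, and this is what makes integrality transitive.
\<close>

definition multiplier :: "'a set \<Rightarrow> 'a set" where
  "multiplier T = {c. \<forall>y\<in>span T. c * y \<in> span T}"

lemma multiplierI:
  assumes "\<And>t. t \<in> T \<Longrightarrow> c * t \<in> span T"
  shows "c \<in> multiplier T"
proof -
  have "c * y \<in> span T" if "y \<in> span T" for y
    using that
  proof (induction rule: span_induct_alt)
    case (step d t y)
    then show ?case
      using assms[of t] by (simp add: distrib_left scale_mult_right span_add span_scale)
  qed (simp add: span_zero)
  then show ?thesis by (simp add: multiplier_def)
qed

lemma multiplierD: "c \<in> multiplier T \<Longrightarrow> y \<in> span T \<Longrightarrow> c * y \<in> span T"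
  by (simp add: multiplier_def)

lemma multiplier_scale_1: "scale d 1 \<in> multiplier T"
  by (simp add: multiplier_def scale_mult_left span_scale)

text \<open>
  The set \<open>T'\<close> consists of the products \<open>t x\<^sup>j\<close> with \<open>j\<close> up to and including the degree of \<open>p\<close>. With
  the top exponent included, \<open>T'\<close> contains \<open>T\<close> whatever the degree is; the relation
  used to reduce exponents is accordingly \<open>x p(x) = 0\<close> instead of \<open>p(x) = 0\<close>.
\<close>

lemma multiplier_adjoin_root:
  assumes T: "finite T" "1 \<in> span T"
    and p: "lead_coeff p = 1" "\<And>i. coeff p i \<in> multiplier T" "poly p x = 0"
  obtains T' where "finite T'" "1 \<in> span T'" "multiplier T \<subseteq> multiplier T'" "x \<in> multiplier T'"
proof
  define n where "n = degree p"
  define T' where "T' = (\<lambda>(t, j). t * x ^ j) ` (T \<times> {..n})"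
  show "finite T'" using T by (simp add: T'_def)
  have shift: "y * x ^ j \<in> span T'" if "y \<in> span T" "j \<le> n" for y j
    using that(1)
  proof (induction rule: span_induct_alt)
    case (step d t y)
    then have "t * x ^ j \<in> span T'"
      using \<open>j \<le> n\<close> by (intro span_base) (auto simp: T'_def)
    then show ?case
      using step by (simp add: distrib_right scale_mult_left span_add span_scale)
  qed (simp add: span_zero)
  show "1 \<in> span T'" using shift[OF T(2), of 0] by simp
  show "multiplier T \<subseteq> multiplier T'"
  proof
    fix c assume "c \<in> multiplier T"
    have "c * t' \<in> span T'" if "t' \<in> T'" for t'
    proof -
      obtain t j where t: "t \<in> T" "j \<le> n" "t' = t * x ^ j"
        using \<open>t' \<in> T'\<close> by (auto simp: T'_def)
      have "c * t * x ^ j \<in> span T'"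
        using \<open>c \<in> multiplier T\<close> t by (intro shift multiplierD span_base)
      then show ?thesis by (simp add: t mult.assoc)
    qed
    then show "c \<in> multiplier T'" by (rule multiplierI)
  qed
  show "x \<in> multiplier T'"
  proof (rule multiplierI)
    fix t' assume "t' \<in> T'"
    then obtain t j where t: "t \<in> T" "j \<le> n" "t' = t * x ^ j" by (auto simp: T'_def)
    show "x * t' \<in> span T'"
    proof (cases "j < n")
      case True
      then have "t * x ^ Suc j \<in> span T'" using t by (intro shift span_base) auto
      then show ?thesis by (simp add: t ac_simps)
    next
      case False
      with t have "x * t' = t * x * x ^ n" by (simp add: ac_simps)
      also have "\<dots> = - (\<Sum>i<n. (coeff p i * t) * x ^ Suc i)"
        using monic_root_power_degree[OF p(1,3)]
        by (simp add: n_def sum_distrib_left ac_simps)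
      also have "\<dots> \<in> span T'"
        using t p(2) by (intro span_neg span_sum shift multiplierD span_base) auto
      finally show ?thesis .
    qed
  qed
qed

lemma poly_map_poly_scale: "poly (map_poly (\<lambda>d. scale d 1) h) x = eval_poly h x"
  by (induction h) (simp_all add: Polynomial.map_poly_pCons)

lemma finite_integral_multiplier:
  assumes "finite C" "\<And>c. c \<in> C \<Longrightarrow> integral_element c"
  shows "\<exists>T. finite T \<and> 1 \<in> span T \<and> C \<subseteq> multiplier T"
  using assms
proof (induction C rule: finite_induct)
  case empty
  show ?case by (intro exI[of _ "{1}"]) (simp add: span_base)
next
  case (insert c C)
  then obtain T where T: "finite T" "1 \<in> span T" "C \<subseteq> multiplier T" by blast
  obtain h where h: "lead_coeff h = 1" "eval_poly h c = 0"
    using insert.prems[of c] by (auto simp: integral_element_def)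
  let ?p = "map_poly (\<lambda>d. scale d 1) h"
  have "lead_coeff ?p = 1"
    using h(1) lead_coeff_map_poly_nz[of "\<lambda>d. scale d 1" h] by simp
  then obtain T' where "finite T'" "1 \<in> span T'" "multiplier T \<subseteq> multiplier T'" "c \<in> multiplier T'"
    by (rule multiplier_adjoin_root[OF T(1,2)])
      (use h in \<open>simp_all add: coeff_map_poly multiplier_scale_1 poly_map_poly_scale\<close>)
  with T(3) show ?case by blast
qed

lemma integral_element_trans:
  assumes p: "lead_coeff p = 1" "\<And>i. integral_element (coeff p i)" "poly p x = 0"
  shows "integral_element x"
proof -
  obtain T where T: "finite T" "1 \<in> span T" "coeff p ` {..degree p} \<subseteq> multiplier T"
    using finite_integral_multiplier[of "coeff p ` {..degree p}"] p(2) by auto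
  have "coeff p i \<in> multiplier T" for i
    using T(3) multiplier_scale_1[of 0 T] by (cases "i \<le> degree p") (auto simp: coeff_eq_0)
  then obtain T' where T': "finite T'" "1 \<in> span T'" "x \<in> multiplier T'"
    using multiplier_adjoin_root[OF T(1,2) p(1) _ p(3)] by blast
  show ?thesis
    by (rule determinant_trick[OF T'(1,2), of x])
      (use T'(3) in \<open>auto simp: integral_element_def multiplier_def span_base\<close>)
qed

end

section \<open>Polynomials over a field\<close>

lemma poly_map_poly_hom:
  assumes "h 0 = 0" "\<And>x y. h (x + y) = h x + h y" "\<And>x y. h (x * y) = h x * h y"
  shows "poly (map_poly h p) (h x) = h (poly p x)"
  by (induction p) (simp_all add: assms Polynomial.map_poly_pCons)

lemma ex_map_poly_preimage:
  assumes "j 0 = 0" "inj j" "\<And>i. coeff p i \<in> range j"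
  shows "\<exists>q. map_poly j q = p"
proof
  have "inv_into UNIV j 0 = 0"
    using inv_f_f[OF assms(2), of 0] assms(1) by simp
  then show "map_poly j (map_poly (inv_into UNIV j) p) = p"
    using assms by (intro poly_eqI) (simp add: coeff_map_poly f_inv_into_f)
qed

text \<open>
  Each of the linear factors of \<open>p\<close> divides \<open>q\<close>, and there are as many as the degree of \<open>p\<close>.
\<close>

lemma alg_closed_dvd_power_degree:
  fixes p q :: "'l::alg_closed_field poly"
  assumes "p \<noteq> 0" and roots: "\<And>x. poly p x = 0 \<Longrightarrow> poly q x = 0"
  shows "p dvd q ^ degree p"
proof -
  obtain A where A: "size A = degree p" "p = smult (lead_coeff p) (\<Prod>x\<in>#A. [:- x, 1:])"
    using alg_closed_imp_factorization[OF \<open>p \<noteq> 0\<close>] by blast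
  have "(\<Prod>x\<in>#B. [:- x, 1:]) dvd q ^ size B" if "\<And>x. x \<in># B \<Longrightarrow> poly q x = 0" for B
    using that by (induction B) (auto intro!: mult_dvd_mono simp: poly_eq_0_iff_dvd simp del: mult_pCons_left)
  moreover have "poly q x = 0" if "x \<in># A" for x
  proof (rule roots)
    have "[:- x, 1:] dvd (\<Prod>x\<in>#A. [:- x, 1:])" using that by (intro dvd_prod_mset) auto
    then have "[:- x, 1:] dvd p" by (subst A(2)) (rule dvd_smult)
    then show "poly p x = 0" by (simp add: poly_eq_0_iff_dvd)
  qed
  ultimately have "(\<Prod>x\<in>#A. [:- x, 1:]) dvd q ^ degree p" using A(1) by metis
  then show ?thesis using \<open>p \<noteq> 0\<close> by (subst A(2)) (simp add: smult_dvd_iff)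
qed

text \<open>
  An element of least degree generates the ideal, by division with remainder.
\<close>

lemma field_poly_ideal_principal:
  fixes I :: "'k::field poly set"
  assumes nonzero: "p \<in> I" "p \<noteq> 0"
    and add: "\<And>f g. f \<in> I \<Longrightarrow> g \<in> I \<Longrightarrow> f + g \<in> I"
    and mult: "\<And>f g. f \<in> I \<Longrightarrow> f * g \<in> I"
  obtains m where "lead_coeff m = 1" "I = {f. m dvd f}"
proof -
  obtain q where q: "q \<in> I" "q \<noteq> 0" and min: "\<And>f. f \<in> I \<Longrightarrow> f \<noteq> 0 \<Longrightarrow> degree q \<le> degree f"
    using ex_has_least_nat[of "\<lambda>f. f \<in> I \<and> f \<noteq> 0" p degree] nonzero by blast
  have "f \<in> I \<longleftrightarrow> q dvd f" for f
  proof
    assume f: "f \<in> I"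
    have "f + q * - (f div q) \<in> I" by (intro add mult f q)
    then have "f mod q \<in> I" by (simp add: minus_mult_div_eq_mod)
    have "f mod q = 0"
    proof (rule ccontr)
      assume "f mod q \<noteq> 0"
      with \<open>f mod q \<in> I\<close> have "degree q \<le> degree (f mod q)" by (rule min)
      with degree_mod_less'[OF q(2) \<open>f mod q \<noteq> 0\<close>] show False by simp
    qed
    then show "q dvd f" by (simp add: dvd_eq_mod_eq_0)
  qed (auto intro: mult q)
  moreover have "smult (inverse (lead_coeff q)) q dvd f \<longleftrightarrow> q dvd f" for f
    using q(2) by (simp add: smult_dvd_iff)
  ultimately show thesis
    using q(2) by (intro that[of "smult (inverse (lead_coeff q)) q"]) auto
qed

text \<open>
  \<open>K[X]\<close> is integrally closed. The polynomials \<open>q\<close> for which all \<open>q \<phi>\<^sup>i\<close> are polynomials form an ideal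
  \<open>J\<close>, which is nonzero because it contains a power of the denominator of \<open>\<phi>\<close>. For a generator
  \<open>m\<close>, the element \<open>m \<phi>\<close> is again in \<open>J\<close>, hence a multiple \<open>m r\<close> of \<open>m\<close>, and \<open>\<phi> = r\<close>.
\<close>

lemma integral_over_field_poly_imp_poly:
  fixes \<phi> :: "'k::field poly fract"
  assumes "integral_over (range to_fract) \<phi>"
  shows "\<phi> \<in> range to_fract"
proof -
  let ?R = "range (to_fract :: 'k poly \<Rightarrow> _)"
  obtain p where p: "lead_coeff p = 1" "\<And>i. coeff p i \<in> ?R" "poly p \<phi> = 0"
    using assms by (auto simp: integral_over_def)
  have R_minus: "- x \<in> ?R" if "x \<in> ?R" for x
    using that by (auto simp flip: to_fract_uminus)
  have R_add: "x + y \<in> ?R" if "x \<in> ?R" "y \<in> ?R" for x y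
    using that by (auto simp flip: to_fract_add)
  have R_mult: "x * y \<in> ?R" if "x \<in> ?R" "y \<in> ?R" for x y
    using that by (auto simp flip: to_fract_mult)
  have R_sum: "(\<Sum>i\<in>A. f i) \<in> ?R" if "\<And>i. i \<in> A \<Longrightarrow> f i \<in> ?R" for f and A :: "nat set"
  proof -
    have "(\<Sum>i\<in>A. f i) = to_fract (\<Sum>i\<in>A. inv_into UNIV to_fract (f i))"
      using that by (simp add: f_inv_into_f)
    then show ?thesis by blast
  qed
  define J where "J = {q :: 'k poly. \<forall>i. to_fract q * \<phi> ^ i \<in> ?R}"
  define n where "n = degree p"
  obtain a b where ab: "\<phi> = to_fract a / to_fract b" "b \<noteq> 0"
    by (cases \<phi>) (auto simp: Fract_conv_to_fract)
  \<comment> \<open>Up to exponent \<open>n\<close> the power of the denominator suffices; higher powers reduce to lower ones.\<close>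
  have "to_fract (b ^ n) * \<phi> ^ i \<in> ?R" for i
  proof (induction i rule: less_induct)
    case (less i)
    show ?case
    proof (cases "i \<le> n")
      case True
      have pow: "to_fract (c ^ k) = to_fract c ^ k" for c :: "'k poly" and k
        by (induction k) simp_all
      have "to_fract b ^ n = to_fract b ^ (n - i) * to_fract b ^ i"
        using True by (simp flip: power_add)
      then have "to_fract (b ^ n) * \<phi> ^ i = to_fract (b ^ (n - i) * a ^ i)"
        using ab(2) by (simp add: ab(1) pow power_divide)
      then show ?thesis by blast
    next
      case False
      have "to_fract (b ^ n) * \<phi> ^ i = to_fract (b ^ n) * \<phi> ^ (i - n) * \<phi> ^ n"
        using False by (simp flip: power_add)
      also have "\<dots> = - (\<Sum>k<n. coeff p k * (to_fract (b ^ n) * \<phi> ^ (i - n + k)))"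
        using monic_root_power_degree[OF p(1,3)]
        by (simp add: n_def sum_distrib_left power_add ac_simps)
      also have "\<dots> \<in> ?R"
        using False by (intro R_minus R_sum R_mult p less) auto
      finally show ?thesis .
    qed
  qed
  then have "b ^ n \<in> J" by (simp add: J_def)
  moreover have "b ^ n \<noteq> 0" using ab(2) by simp
  moreover have "f + g \<in> J" if "f \<in> J" "g \<in> J" for f g
    using that by (simp add: J_def distrib_right R_add)
  moreover have "f * g \<in> J" if f: "f \<in> J" for f g
  proof -
    have "to_fract (f * g) * \<phi> ^ i \<in> ?R" for i
    proof -
      have "to_fract (f * g) * \<phi> ^ i = to_fract g * (to_fract f * \<phi> ^ i)"
        by simp
      also have "\<dots> \<in> ?R"
        by (rule R_mult) (use f in \<open>simp_all add: J_def\<close>)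
      finally show ?thesis .
    qed
    then show ?thesis by (simp add: J_def)
  qed
  ultimately obtain m where m: "lead_coeff m = 1" "J = {f. m dvd f}"
    by (rule field_poly_ideal_principal)
  then have "m \<in> J" by simp
  then have "to_fract m * \<phi> ^ 1 \<in> ?R" unfolding J_def by blast
  then obtain q where q: "to_fract m * \<phi> = to_fract q" by auto
  have "q \<in> J"
  proof -
    have "to_fract q * \<phi> ^ i = to_fract m * \<phi> ^ Suc i" for i
      by (simp flip: q)
    then show ?thesis using \<open>m \<in> J\<close> by (simp add: J_def del: power_Suc)
  qed
  then have "m dvd q" using m(2) by simp
  then obtain r where "q = m * r" by (rule dvdE)
  moreover have "m \<noteq> 0" using m(1) by auto
  ultimately have "\<phi> = to_fract r" using q by simp
  then show ?thesis by blast
qed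

section \<open>The tensor product of the algebra with the quotient field\<close>

text \<open>
  In this form the bilinearity of the product is that of the linear extension of maps to free
  abelian groups.
\<close>

lemma free_mult_conv_frag_extend:
  "free_mult u v =
     frag_extend (\<lambda>p. frag_extend (\<lambda>q. frag_of (fst p * fst q, snd p * snd q)) v) u"
proof -
  have "frag_cmul c (Poly_Mapping.single x d) = Poly_Mapping.single x (c * d)"
    for c d :: int and x :: "'a \<times> 'b"
    by (rule poly_mapping_eqI) (simp add: lookup_single when_def)
  then show ?thesis
    by (simp add: free_mult_def frag_extend_def frag_cmul_sum)
qed

lemma frag_cmul_diff_right: "frag_cmul c (x - y) = frag_cmul c x - frag_cmul c y"
  by (rule poly_mapping_eqI) (simp add: lookup_minus algebra_simps)

lemma frag_extend_diff_fun:
  "frag_extend (\<lambda>p. f p - g p) u = frag_extend f u - frag_extend g u"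
  by (simp add: frag_extend_def frag_cmul_diff_right sum_subtractf)

lemma free_mult_diff_left: "free_mult (u - v) w = free_mult u w - free_mult v w"
  by (simp add: free_mult_conv_frag_extend frag_extend_diff)

lemma free_mult_diff_right: "free_mult u (v - w) = free_mult u v - free_mult u w"
  by (simp add: free_mult_conv_frag_extend frag_extend_diff frag_extend_diff_fun)

lemma free_mult_of: "free_mult (frag_of p) (frag_of q) = frag_of (fst p * fst q, snd p * snd q)"
  by (simp add: free_mult_conv_frag_extend)

lemma free_mult_0 [simp]: "free_mult 0 v = 0" "free_mult u 0 = 0"
  using free_mult_diff_left[of 0 0 v] free_mult_diff_right[of u 0 0] by simp_all

lemma free_mult_minus: "free_mult (- u) v = - free_mult u v" "free_mult u (- v) = - free_mult u v"
  using free_mult_diff_left[of 0 u v] free_mult_diff_right[of u 0 v] by simp_all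

lemma free_mult_add_left: "free_mult (u + v) w = free_mult u w + free_mult v w"
  using free_mult_diff_left[of u "- v" w] by (simp add: free_mult_minus)

lemma free_mult_add_right: "free_mult u (v + w) = free_mult u v + free_mult u w"
  using free_mult_diff_right[of u v "- w"] by (simp add: free_mult_minus)

lemma frag_induct [case_names zero of diff]:
  fixes c :: "'b \<Rightarrow>\<^sub>0 int"
  assumes "P 0" "\<And>x. P (frag_of x)" "\<And>a b. P a \<Longrightarrow> P b \<Longrightarrow> P (a - b)"
  shows "P c"
  by (rule frag_induction[of c UNIV]) (use assms in \<open>blast+\<close>)

lemma free_mult_assoc: "free_mult (free_mult u v) w = free_mult u (free_mult v w)"
proof (induction u rule: frag_induct)
  case (of p)
  show ?case
  proof (induction v rule: frag_induct)
    case (of q)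
    show ?case
      by (induction w rule: frag_induct) (simp_all add: free_mult_of free_mult_diff_right mult.assoc)
  qed (simp_all add: free_mult_diff_left free_mult_diff_right)
qed (simp_all add: free_mult_diff_left)

lemma free_mult_1 [simp]: "free_mult (frag_of (1, 1)) u = u" "free_mult u (frag_of (1, 1)) = u"
  by (induction u rule: frag_induct)
    (simp_all add: free_mult_of free_mult_diff_left free_mult_diff_right)

lemma free_ring_simps [simp]:
  "carrier free_ring = UNIV" "mult free_ring = free_mult" "one free_ring = frag_of (1, 1)"
  "zero free_ring = 0" "add free_ring = (+)"
  by (simp_all add: free_ring_def)

lemma ring_free_ring: "ring (free_ring :: ('a::ring_1 \<times> 'k::field \<Rightarrow>\<^sub>0 int) ring)"
proof (rule ringI)
  show "abelian_group (free_ring :: ('a \<times> 'k \<Rightarrow>\<^sub>0 int) ring)"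
  proof (rule abelian_groupI)
    fix u :: "'a \<times> 'k \<Rightarrow>\<^sub>0 int"
    show "\<exists>v\<in>carrier free_ring. v \<oplus>\<^bsub>free_ring\<^esub> u = \<zero>\<^bsub>free_ring\<^esub>"
      by (auto intro!: exI[of _ "- u"])
  qed (simp_all add: ac_simps)
  show "Group.monoid (free_ring :: ('a \<times> 'k \<Rightarrow>\<^sub>0 int) ring)"
    by (rule monoidI) (simp_all add: free_mult_assoc)
qed (simp_all add: free_mult_add_left free_mult_add_right)

lemma a_inv_free_ring [simp]: "\<ominus>\<^bsub>free_ring\<^esub> u = - u"
proof -
  interpret ring free_ring by (rule ring_free_ring)
  show ?thesis by (rule minus_equality) simp_all
qed

text \<open>
  Negation in the form to which the simplifier unfolds inverses in the additive monoid of the ring.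
\<close>

lemmas m_inv_free_ring [simp] = a_inv_free_ring[unfolded a_inv_def, simplified]

lemma a_minus_free_ring [simp]: "u \<ominus>\<^bsub>free_ring\<^esub> v = u - v"
  by (simp add: a_minus_def)

locale torsion_free_algebra = associative_algebra scale
  for scale :: "'d::idom \<Rightarrow> 'a::ring_1 \<Rightarrow> 'a" +
  assumes torsion_free: "torsion_free scale"
begin

lemma scale_eq_0_cancel: "scale d x = 0 \<Longrightarrow> d \<noteq> 0 \<Longrightarrow> x = 0"
  using torsion_free by (auto simp: torsion_free_def)

abbreviation (input) e :: "'a \<Rightarrow> 'd fract \<Rightarrow> ('a \<times> 'd fract \<Rightarrow>\<^sub>0 int)" where
  "e a k \<equiv> frag_of (a, k)"

lemma tensor_relations_cases [consumes 1, case_names left right balanced]: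
  assumes "r \<in> tensor_relations scale"
  obtains a b k where "r = e (a + b) k - e a k - e b k"
  | a k l where "r = e a (k + l) - e a k - e a l"
  | d a k where "r = e (scale d a) k - e a (to_fract d * k)"
  using assms unfolding tensor_relations_def Let_def by blast

lemma tensor_relationsI:
  "e (a + b) k - e a k - e b k \<in> tensor_relations scale"
  "e a (k + l) - e a k - e a l \<in> tensor_relations scale"
  "e (scale d a) k - e a (to_fract d * k) \<in> tensor_relations scale"
  unfolding tensor_relations_def Let_def by blast+

lemma subgroup_tensor_null: "subgroup (tensor_null scale) (add_monoid free_ring)"
proof -
  interpret ring "free_ring :: ('a \<times> 'd fract \<Rightarrow>\<^sub>0 int) ring" by (rule ring_free_ring)
  show ?thesis unfolding tensor_null_def
    by (rule add.generate_is_subgroup) simp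
qed

lemma tensor_null_closed:
  "0 \<in> tensor_null scale"
  "u \<in> tensor_null scale \<Longrightarrow> v \<in> tensor_null scale \<Longrightarrow> u + v \<in> tensor_null scale"
  "u \<in> tensor_null scale \<Longrightarrow> - u \<in> tensor_null scale"
  using subgroup.one_closed[OF subgroup_tensor_null] subgroup.m_closed[OF subgroup_tensor_null, of u v]
    subgroup.m_inv_closed[OF subgroup_tensor_null, of u]
  by simp_all

lemma tensor_null_diff:
  "u \<in> tensor_null scale \<Longrightarrow> v \<in> tensor_null scale \<Longrightarrow> u - v \<in> tensor_null scale"
  using tensor_null_closed(2)[of u "- v"] by (simp add: tensor_null_closed)

lemma tensor_null_relation: "r \<in> tensor_relations scale \<Longrightarrow> r \<in> tensor_null scale"
  unfolding tensor_null_def by (rule generate.incl)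

lemma tensor_null_induct [consumes 1, case_names zero relation minus add]:
  assumes "u \<in> tensor_null scale"
    and "P 0" "\<And>r. r \<in> tensor_relations scale \<Longrightarrow> P r"
    and "\<And>u. P u \<Longrightarrow> P (- u)" "\<And>u v. P u \<Longrightarrow> P v \<Longrightarrow> P (u + v)"
  shows "P u"
  using assms(1) unfolding tensor_null_def
  by (induction rule: generate.induct) (use assms(2-) in simp_all)

text \<open>
  Multiplying a defining relation by a generator yields another relation of the same kind.
\<close>

lemma tensor_relation_mult_null:
  assumes "r \<in> tensor_relations scale"
  shows "free_mult u r \<in> tensor_null scale" "free_mult r u \<in> tensor_null scale"
proof -
  have "free_mult u r \<in> tensor_null scale \<and> free_mult r u \<in> tensor_null scale"
  proof (induction u rule: frag_induct)
    case (of p)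
    obtain x m where p: "p = (x, m)" by (cases p)
    from assms have "free_mult (frag_of p) r \<in> tensor_relations scale \<and>
      free_mult r (frag_of p) \<in> tensor_relations scale"
    proof (cases rule: tensor_relations_cases)
      case (left a b k)
      then show ?thesis
        using tensor_relationsI(1)[of "x * a" "x * b" "m * k"]
          tensor_relationsI(1)[of "a * x" "b * x" "k * m"]
        by (simp add: p free_mult_diff_left free_mult_diff_right free_mult_of distrib_left distrib_right)
    next
      case (right a k l)
      then show ?thesis
        using tensor_relationsI(2)[of "x * a" "m * k" "m * l"]
          tensor_relationsI(2)[of "a * x" "k * m" "l * m"]
        by (simp add: p free_mult_diff_left free_mult_diff_right free_mult_of distrib_left distrib_right)
    next
      case (balanced d a k)
      then show ?thesis
        using tensor_relationsI(3)[of d "x * a" "m * k"]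
          tensor_relationsI(3)[of d "a * x" "k * m"]
        by (simp add: p free_mult_diff_left free_mult_diff_right free_mult_of
            scale_mult_left scale_mult_right mult.assoc mult.left_commute)
    qed
    then show ?case by (auto intro: tensor_null_relation)
  qed (auto simp: free_mult_diff_left free_mult_diff_right tensor_null_closed tensor_null_diff)
  then show "free_mult u r \<in> tensor_null scale" "free_mult r u \<in> tensor_null scale" by auto
qed

lemma ideal_tensor_null: "ideal (tensor_null scale) free_ring"
proof (rule idealI[OF ring_free_ring subgroup_tensor_null])
  fix u v :: "'a \<times> 'd fract \<Rightarrow>\<^sub>0 int"
  assume u: "u \<in> tensor_null scale"
  have "free_mult v u \<in> tensor_null scale \<and> free_mult u v \<in> tensor_null scale"
    using u
    by (induction rule: tensor_null_induct)
      (simp_all add: tensor_null_closed tensor_relation_mult_null free_mult_minus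
        free_mult_add_left free_mult_add_right)
  then show "v \<otimes>\<^bsub>free_ring\<^esub> u \<in> tensor_null scale" "u \<otimes>\<^bsub>free_ring\<^esub> v \<in> tensor_null scale"
    by auto
qed

sublocale null: ideal "tensor_null scale" free_ring
  by (rule ideal_tensor_null)

sublocale T: ring "tensor_ring scale"
  unfolding tensor_ring_def by (rule null.quotient_is_ring)

lemma coset_eq_iff:
  "tensor_null scale +>\<^bsub>free_ring\<^esub> u = tensor_null scale +>\<^bsub>free_ring\<^esub> v \<longleftrightarrow> u - v \<in> tensor_null scale"
  using null.quotient_eq_iff_same_a_r_cos[OF ideal_tensor_null, of u v] by simp

lemma coset_hom:
  "(+>\<^bsub>free_ring\<^esub>) (tensor_null scale) \<in> Ring.ring_hom free_ring (tensor_ring scale)"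
  unfolding tensor_ring_def by (rule null.rcos_ring_hom)

lemma tensor_closed [simp]: "tensor scale a k \<in> carrier (tensor_ring scale)"
  unfolding tensor_def using ring_hom_closed[OF coset_hom] by simp

lemma tensor_add_left: "tensor scale (a + b) k = tensor scale a k \<oplus>\<^bsub>tensor_ring scale\<^esub> tensor scale b k"
  unfolding tensor_def using tensor_null_relation[OF tensor_relationsI(1)[of a b k]]
  by (simp add: coset_eq_iff algebra_simps flip: ring_hom_add[OF coset_hom, simplified])

lemma tensor_mult:
  "tensor scale a k \<otimes>\<^bsub>tensor_ring scale\<^esub> tensor scale b l = tensor scale (a * b) (k * l)"
  unfolding tensor_def by (simp add: free_mult_of flip: ring_hom_mult[OF coset_hom, simplified])

lemma tensor_1: "tensor scale 1 1 = \<one>\<^bsub>tensor_ring scale\<^esub>"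
  unfolding tensor_def using ring_hom_one[OF coset_hom] by simp

lemma tensor_scale: "tensor scale (scale d a) k = tensor scale a (to_fract d * k)"
  unfolding tensor_def by (simp add: coset_eq_iff tensor_null_relation tensor_relationsI)

lemma tensor_0: "tensor scale 0 k = \<zero>\<^bsub>tensor_ring scale\<^esub>"
  using tensor_add_left[of 0 0 k] by (simp add: T.add.r_cancel_one')

lemma tensor_power: "tensor scale s 1 [^]\<^bsub>tensor_ring scale\<^esub> (i::nat) = tensor scale (s ^ i) 1"
  by (induction i) (simp_all add: tensor_1 tensor_mult power_commutes)

lemma tensor_sum:
  "(\<Oplus>\<^bsub>tensor_ring scale\<^esub>i\<in>{..n::nat}. tensor scale (h i) k) = tensor scale (\<Sum>i\<le>n. h i) k"
  by (induction n) (simp_all add: T.finsum_Suc tensor_add_left T.a_comm)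

text \<open>
  Over a common denominator of the coefficients all summands are pure tensors with the same scalar, so
  the value of \<open>f\<close> in \<open>B\<close> collapses to a single pure tensor.
\<close>

lemma tensor_eval_eq_tensor:
  assumes "d \<noteq> 0" and f: "smult (to_fract d) f = fract_poly g"
  shows "tensor_eval scale f s = tensor scale (eval_poly g s) (inverse (to_fract d))"
proof -
  have deg: "degree f = degree g"
    using arg_cong[OF f, of degree] \<open>d \<noteq> 0\<close> by (simp add: degree_map_poly)
  have coeff: "coeff f i = to_fract (coeff g i) * inverse (to_fract d)" for i
    using arg_cong[OF f, of "\<lambda>p. coeff p i"] \<open>d \<noteq> 0\<close> by (simp add: coeff_map_poly field_simps)
  have "tensor scale 1 (coeff f i) \<otimes>\<^bsub>tensor_ring scale\<^esub> (tensor scale s 1 [^]\<^bsub>tensor_ring scale\<^esub> i)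
      = tensor scale (scale (coeff g i) (s ^ i)) (inverse (to_fract d))" for i
    by (simp add: tensor_power tensor_mult tensor_scale coeff)
  then show ?thesis
    by (simp add: tensor_eval_def tensor_sum deg eval_poly_eq_sum)
qed

text \<open>
  The value in \<open>A\<close> of \<open>d u\<close>, provided that \<open>d\<close> is a common denominator of the scalars occurring in
  \<open>u\<close>: the term \<open>inv_into UNIV to_fract x\<close> is \<open>x\<close> seen as an element of \<open>D\<close> if \<open>x\<close> belongs to \<open>D\<close>, and an
  unspecified element otherwise. For fixed \<open>d\<close> the map is additive in either case.
\<close>

definition clear_denom :: "'d \<Rightarrow> ('a \<times> 'd fract \<Rightarrow>\<^sub>0 int) \<Rightarrow> 'a" where
  "clear_denom d u = (\<Sum>p\<in>Poly_Mapping.keys u.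
     scale (inv_into UNIV to_fract (to_fract d * snd p)) (of_int (Poly_Mapping.lookup u p) * fst p))"

lemma inv_to_fract [simp]: "inv_into UNIV to_fract (to_fract x) = (x :: 'd)"
  by (rule inv_f_f) (simp add: inj_def)

lemma clear_denom_superset:
  assumes "finite P" "Poly_Mapping.keys u \<subseteq> P"
  shows "clear_denom d u = (\<Sum>p\<in>P.
     scale (inv_into UNIV to_fract (to_fract d * snd p)) (of_int (Poly_Mapping.lookup u p) * fst p))"
  unfolding clear_denom_def using assms
  by (intro sum.mono_neutral_left) (auto simp: in_keys_iff)

lemma clear_denom_add: "clear_denom d (u + v) = clear_denom d u + clear_denom d v"
proof -
  let ?P = "Poly_Mapping.keys u \<union> Poly_Mapping.keys v"
  show ?thesis
    by (subst (1 2 3) clear_denom_superset[of ?P])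
      (auto simp: lookup_add distrib_right scale_right_distrib sum.distrib dest: set_mp[OF keys_add])
qed

lemma clear_denom_0 [simp]: "clear_denom d 0 = 0"
  by (simp add: clear_denom_def)

lemma clear_denom_minus: "clear_denom d (- u) = - clear_denom d u"
  using clear_denom_add[of d u "- u"] by (simp add: eq_neg_iff_add_eq_0 add.commute)

lemma clear_denom_diff: "clear_denom d (u - v) = clear_denom d u - clear_denom d v"
  using clear_denom_add[of d u "- v"] by (simp add: clear_denom_minus)

lemma clear_denom_of: "clear_denom d (e a k) = scale (inv_into UNIV to_fract (to_fract d * k)) a"
  by (simp add: clear_denom_def)

lemma ex_denominator: "\<exists>d n. d \<noteq> 0 \<and> to_fract d * k = to_fract n" for k :: "'d fract"
proof (cases k)
  case (Fract n d)
  then have "d \<noteq> 0 \<and> to_fract d * k = to_fract n" by (simp add: Fract_conv_to_fract)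
  then show ?thesis by blast
qed

text \<open>
  The invariant that separates tensors. Quantifying over all multiples of \<open>d\<close>
  makes the property stable under sums, where the two denominators are multiplied.
\<close>

lemma clear_denom_tensor_null:
  assumes "u \<in> tensor_null scale"
  shows "\<exists>d. d \<noteq> 0 \<and> (\<forall>c. clear_denom (c * d) u = 0)"
  using assms
proof (induction rule: tensor_null_induct)
  case (relation r)
  then show ?case
  proof (cases rule: tensor_relations_cases)
    case (left a b k)
    then show ?thesis
      by (intro exI[of _ 1]) (simp add: clear_denom_diff clear_denom_of scale_right_distrib)
  next
    case (right a k l)
    obtain d n where d: "d \<noteq> 0" "to_fract d * k = to_fract n" using ex_denominator by blast
    obtain d' n' where d': "d' \<noteq> 0" "to_fract d' * l = to_fract n'" using ex_denominator by blast
    have "to_fract (c * (d * d')) * k = to_fract (c * d' * n)" for c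
      using d(2) by (simp add: ac_simps)
    moreover have "to_fract (c * (d * d')) * l = to_fract (c * d * n')" for c
      using d'(2) by (simp add: ac_simps)
    ultimately show ?thesis using d(1) d'(1)
      by (intro exI[of _ "d * d'"])
        (simp add: right clear_denom_diff clear_denom_of distrib_left scale_left_distrib
          del: to_fract_mult to_fract_add flip: to_fract_add)
  next
    case (balanced d' a k)
    obtain d n where d: "d \<noteq> 0" "to_fract d * k = to_fract n" using ex_denominator by blast
    have "to_fract (c * d) * k = to_fract (c * n)" for c
      using d(2) by (simp add: ac_simps)
    moreover have "to_fract (c * d) * (to_fract d' * k) = to_fract (c * n * d')" for c
      using d(2) by (simp add: ac_simps)
    ultimately show ?thesis using d(1)
      by (intro exI[of _ d])
        (simp add: balanced clear_denom_diff clear_denom_of del: to_fract_mult)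
  qed
next
  case (minus u)
  then show ?case by (auto simp: clear_denom_minus)
next
  case (add u v)
  then obtain d d' where "d \<noteq> 0" "\<And>c. clear_denom (c * d) u = 0"
    "d' \<noteq> 0" "\<And>c. clear_denom (c * d') v = 0" by blast
  then have "clear_denom (c * (d * d')) (u + v) = 0" for c
    using \<open>clear_denom ((c * d') * d) u = 0\<close> \<open>clear_denom ((c * d) * d') v = 0\<close>
    by (simp add: clear_denom_add ac_simps)
  then show ?case
    using \<open>d \<noteq> 0\<close> \<open>d' \<noteq> 0\<close> by (intro exI[of _ "d * d'"]) simp
qed (auto intro: exI[of _ 1])

text \<open>
  For \<open>d = 1\<close> this is the injectivity of \<open>A \<rightarrow> B\<close>. Clearing denominators in \<open>a \<otimes> 1/d = b \<otimes> 1\<close> gives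
  \<open>c a = c d b\<close> for some nonzero \<open>c\<close>, which can be cancelled as \<open>A\<close> is torsion-free.
\<close>

lemma tensor_inverse_eq_iff:
  assumes "d \<noteq> 0"
  shows "tensor scale a (inverse (to_fract d)) = tensor scale b 1 \<longleftrightarrow> a = scale d b"
proof
  assume "a = scale d b"
  then show "tensor scale a (inverse (to_fract d)) = tensor scale b 1"
    using assms by (simp add: tensor_scale)
next
  assume "tensor scale a (inverse (to_fract d)) = tensor scale b 1"
  then have "e a (inverse (to_fract d)) - e b 1 \<in> tensor_null scale"
    by (simp add: tensor_def coset_eq_iff)
  then obtain c where "c \<noteq> 0" "clear_denom (d * c) (e a (inverse (to_fract d)) - e b 1) = 0"
    using clear_denom_tensor_null by blast
  moreover have "to_fract (d * c) * inverse (to_fract d) = to_fract c"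
    using assms by simp
  ultimately have "scale c a = scale (d * c) b"
    by (simp add: clear_denom_diff clear_denom_of del: to_fract_mult)
  then have "scale c (a - scale d b) = 0"
    by (simp add: scale_right_diff_distrib mult.commute)
  then show "a = scale d b"
    using scale_eq_0_cancel \<open>c \<noteq> 0\<close> by fastforce
qed

end

section \<open>Values of polynomials and minimal polynomials\<close>

lemma poly_common_denominator:
  "\<exists>d g. d \<noteq> 0 \<and> smult (to_fract d) f = fract_poly g" for f :: "'d::idom fract poly"
proof (induction f)
  case (pCons x f)
  then obtain d g where d: "d \<noteq> 0" "smult (to_fract d) f = fract_poly g" by blast
  obtain a b where x: "x = to_fract a / to_fract b" "b \<noteq> 0"
    by (cases x) (auto simp: Fract_conv_to_fract)
  have "smult (to_fract (d * b)) (pCons x f) = fract_poly (pCons (d * a) (smult b g))"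
    using x d by (simp add: Polynomial.map_poly_pCons mult.commute[of "to_fract d"] flip: smult_smult)
  moreover have "d * b \<noteq> 0" using d(1) x(2) by simp
  ultimately show ?case by blast
qed (auto intro: exI[of _ 1])

context torsion_free_algebra
begin

text \<open>
  The equation \<open>f(s) = a\<close> in \<open>B\<close> with \<open>a\<close> in \<open>A\<close>, expressed inside \<open>A\<close> by clearing the denominators of \<open>f\<close>.
\<close>

definition value_at :: "'d fract poly \<Rightarrow> 'a \<Rightarrow> 'a \<Rightarrow> bool" where
  "value_at f s a \<longleftrightarrow>
     (\<exists>d g. d \<noteq> 0 \<and> smult (to_fract d) f = fract_poly g \<and> eval_poly g s = scale d a)"

lemma tensor_eval_eq_iff_value_at: "tensor_eval scale f s = tensor scale a 1 \<longleftrightarrow> value_at f s a"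
proof
  assume "tensor_eval scale f s = tensor scale a 1"
  moreover obtain d g where dg: "d \<noteq> 0" "smult (to_fract d) f = fract_poly g"
    using poly_common_denominator by blast
  ultimately have "eval_poly g s = scale d a"
    by (simp add: tensor_eval_eq_tensor tensor_inverse_eq_iff)
  with dg show "value_at f s a"
    unfolding value_at_def by blast
next
  assume "value_at f s a"
  then obtain d g where "d \<noteq> 0" "smult (to_fract d) f = fract_poly g" "eval_poly g s = scale d a"
    by (auto simp: value_at_def)
  then show "tensor_eval scale f s = tensor scale a 1"
    by (simp add: tensor_eval_eq_tensor tensor_inverse_eq_iff)
qed

lemma tensor_eval_eq_0_iff: "tensor_eval scale f s = \<zero>\<^bsub>tensor_ring scale\<^esub> \<longleftrightarrow> value_at f s 0"
  by (simp flip: tensor_0[of 1] add: tensor_eval_eq_iff_value_at)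

lemma Int_alg_iff: "f \<in> Int_alg scale S \<longleftrightarrow> (\<forall>s\<in>S. \<exists>a. value_at f s a)"
  by (simp add: Int_alg_def tensor_eval_eq_iff_value_at)

lemma value_at_fract_poly: "value_at (fract_poly g) s (eval_poly g s)"
  unfolding value_at_def by (intro exI[of _ 1] exI[of _ g]) simp

lemma value_at_add:
  assumes "value_at f s a" "value_at f' s a'"
  shows "value_at (f + f') s (a + a')"
proof -
  obtain d g where d: "d \<noteq> 0" "smult (to_fract d) f = fract_poly g" "eval_poly g s = scale d a"
    using assms(1) by (auto simp: value_at_def)
  obtain d' g' where d': "d' \<noteq> 0" "smult (to_fract d') f' = fract_poly g'" "eval_poly g' s = scale d' a'"
    using assms(2) by (auto simp: value_at_def)
  have "smult (to_fract (d * d')) (f + f') = fract_poly (smult d' g + smult d g')"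
    by (simp add: smult_add_right ac_simps flip: d(2) d'(2))
  moreover have "eval_poly (smult d' g + smult d g') s = scale (d * d') (a + a')"
    by (simp add: eval_poly_add eval_poly_smult d(3) d'(3) scale_right_distrib mult.commute)
  moreover have "d * d' \<noteq> 0" using d(1) d'(1) by simp
  ultimately show ?thesis unfolding value_at_def by blast
qed

lemma value_at_mult:
  assumes "value_at f s a" "value_at f' s a'"
  shows "value_at (f * f') s (a * a')"
proof -
  obtain d g where d: "d \<noteq> 0" "smult (to_fract d) f = fract_poly g" "eval_poly g s = scale d a"
    using assms(1) by (auto simp: value_at_def)
  obtain d' g' where d': "d' \<noteq> 0" "smult (to_fract d') f' = fract_poly g'" "eval_poly g' s = scale d' a'"
    using assms(2) by (auto simp: value_at_def)
  have "smult (to_fract (d * d')) (f * f') = fract_poly (g * g')"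
    by (simp add: ac_simps flip: d(2) d'(2))
  moreover have "eval_poly (g * g') s = scale (d * d') (a * a')"
    by (simp add: eval_poly_mult d(3) d'(3) scale_mult_left scale_mult_right mult.commute[of d d'])
  moreover have "d * d' \<noteq> 0" using d(1) d'(1) by simp
  ultimately show ?thesis unfolding value_at_def by blast
qed

text \<open>
  Unlike for general products, the cofactor \<open>k\<close> may take any value in \<open>B\<close> at \<open>s\<close>; hence the polynomials
  vanishing at \<open>s\<close> form an ideal of \<open>K[X]\<close>, and they are integer-valued together with all their multiples.
\<close>

lemma value_at_0_mult:
  assumes "value_at f s 0"
  shows "value_at (f * k) s 0"
proof -
  obtain d g where d: "d \<noteq> 0" "smult (to_fract d) f = fract_poly g" "eval_poly g s = 0"
    using assms by (auto simp: value_at_def)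
  obtain d' g' where d': "d' \<noteq> 0" "smult (to_fract d') k = fract_poly g'"
    using poly_common_denominator by blast
  have "smult (to_fract (d * d')) (f * k) = fract_poly (g * g')"
    by (simp add: ac_simps flip: d(2) d'(2))
  moreover have "eval_poly (g * g') s = scale (d * d') 0"
    by (simp add: eval_poly_mult d(3))
  moreover have "d * d' \<noteq> 0" using d(1) d'(1) by simp
  ultimately show ?thesis unfolding value_at_def by blast
qed

lemma value_at_pcompose:
  assumes "value_at f s a"
  shows "value_at (pcompose (fract_poly h) f) s (eval_poly h a)"
proof (induction h)
  case 0
  show ?case using value_at_fract_poly[of 0 s] by simp
next
  case (pCons c h)
  have "value_at (fract_poly [:c:] + f * pcompose (fract_poly h) f) s (scale c 1 + a * eval_poly h a)"
    using value_at_fract_poly[of "[:c:]" s] by (intro value_at_add value_at_mult assms pCons.IH) simp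
  then show ?case by (simp add: Polynomial.map_poly_pCons pcompose_pCons)
qed

text \<open>
  Integrality of \<open>s\<close> provides a nonzero polynomial vanishing at \<open>s\<close>, so that the ideal of all such
  polynomials has a monic generator.
\<close>

lemma
  assumes "integral_element s"
  shows minimal_poly_monic: "lead_coeff (minimal_poly scale s) = 1"
    and value_at_0_iff_minimal_poly_dvd: "value_at f s 0 \<longleftrightarrow> minimal_poly scale s dvd f"
proof -
  let ?I = "{f. value_at f s 0}"
  obtain h where h: "lead_coeff h = 1" "eval_poly h s = 0"
    using assms by (auto simp: integral_element_def)
  have "fract_poly h \<in> ?I" using value_at_fract_poly[of h s] h(2) by simp
  moreover have "fract_poly h \<noteq> 0" using h(1) by auto
  moreover have "f + g \<in> ?I" if "f \<in> ?I" "g \<in> ?I" for f g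
    using value_at_add[of f s 0 g 0] that by simp
  moreover have "f * g \<in> ?I" if "f \<in> ?I" for f g
    using value_at_0_mult[of f s g] that by simp
  ultimately obtain m where m: "lead_coeff m = 1" "?I = {f. m dvd f}"
    by (rule field_poly_ideal_principal)
  have "minimal_poly scale s = m"
    unfolding minimal_poly_def tensor_eval_eq_0_iff
  proof (rule the_equality)
    show "lead_coeff m = 1 \<and> ?I = {f. m dvd f}" using m by simp
  next
    fix m' assume m': "lead_coeff m' = 1 \<and> ?I = {f. m' dvd f}"
    with m(2) have "{f. m dvd f} = {f. m' dvd f}" by simp
    then have "m dvd f \<longleftrightarrow> m' dvd f" for f by (simp add: set_eq_iff)
    from this[of m] this[of m'] have "m dvd m'" "m' dvd m" by simp_all
    with m(1) m' show "m' = m" by (intro poly_dvd_antisym) auto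
  qed
  then show "lead_coeff (minimal_poly scale s) = 1" "value_at f s 0 \<longleftrightarrow> minimal_poly scale s dvd f"
    using m by (simp_all add: set_eq_iff)
qed

text \<open>
  Polynomials with coefficients in \<open>D\<close> are integer-valued, and every rational function is a quotient
  of two of them.
\<close>

lemma quotient_field_Int_alg: "quotient_field_of (to_fract ` Int_alg scale S) = UNIV"
proof -
  have integer_valued: "fract_poly g \<in> Int_alg scale S" for g
    using value_at_fract_poly by (auto simp: Int_alg_iff)
  have "\<phi> \<in> quotient_field_of (to_fract ` Int_alg scale S)" for \<phi>
  proof -
    obtain a b where ab: "\<phi> = to_fract a / to_fract b" "b \<noteq> 0"
      by (cases \<phi>) (auto simp: Fract_conv_to_fract)
    obtain d g where d: "d \<noteq> 0" "smult (to_fract d) a = fract_poly g"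
      using poly_common_denominator by blast
    obtain d' g' where d': "d' \<noteq> 0" "smult (to_fract d') b = fract_poly g'"
      using poly_common_denominator by blast
    let ?c = "[:to_fract (d * d'):] :: 'd fract poly"
    have "?c * a = fract_poly (smult d' g)" "?c * b = fract_poly (smult d g')"
      by (simp_all add: ac_simps flip: d(2) d'(2))
    then have "?c * a \<in> Int_alg scale S" "?c * b \<in> Int_alg scale S"
      using integer_valued by metis+
    moreover have "?c \<noteq> 0" "?c * b \<noteq> 0" using d(1) d'(1) ab(2) by simp_all
    moreover have "\<phi> = to_fract (?c * a) / to_fract (?c * b)"
      using \<open>?c \<noteq> 0\<close> ab by (simp only: to_fract_mult) simp
    ultimately show ?thesis
      unfolding quotient_field_of_def by (metis (mono_tags, lifting) imageI mem_Collect_eq to_fract_eq_0_iff)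
  qed
  then show ?thesis by blast
qed

end

section \<open>Roots in the algebraic closure\<close>

locale algebra_with_closure = torsion_free_algebra scale
  for scale :: "'d::idom \<Rightarrow> 'a::ring_1 \<Rightarrow> 'a" +
  fixes \<iota> :: "'d fract \<Rightarrow> 'l::alg_closed_field"
  assumes embedding: "algebraic_closure_embedding \<iota>"
    and finitely_generated: "finitely_generated scale"
begin

lemma \<iota>_add: "\<iota> (x + y) = \<iota> x + \<iota> y"
  and \<iota>_mult: "\<iota> (x * y) = \<iota> x * \<iota> y"
  and \<iota>_1 [simp]: "\<iota> 1 = 1"
  using embedding by (simp_all add: algebraic_closure_embedding_def)

lemma \<iota>_0 [simp]: "\<iota> 0 = 0"
  using \<iota>_add[of 0 0] by (simp only: add_0_left add_cancel_right_right)

lemma \<iota>_eq_0_iff [simp]: "\<iota> x = 0 \<longleftrightarrow> x = 0"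
proof
  assume "\<iota> x = 0"
  then have "\<iota> (x * inverse x) = 0" by (simp add: \<iota>_mult)
  then show "x = 0" by (cases "x = 0") simp_all
qed simp

lemma \<iota>_sum: "\<iota> (sum f I) = (\<Sum>i\<in>I. \<iota> (f i))"
  by (induction I rule: infinite_finite_induct) (simp_all add: \<iota>_add)

lemma map_poly_\<iota>_add: "map_poly \<iota> (p + q) = map_poly \<iota> p + map_poly \<iota> q"
  by (rule poly_eqI) (simp add: coeff_map_poly \<iota>_add)

lemma map_poly_\<iota>_mult: "map_poly \<iota> (p * q) = map_poly \<iota> p * map_poly \<iota> q"
  by (rule poly_eqI) (simp add: coeff_map_poly coeff_mult \<iota>_sum \<iota>_mult)

lemma map_poly_\<iota>_power: "map_poly \<iota> (p ^ n) = map_poly \<iota> p ^ n"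
  by (induction n) (simp_all add: map_poly_\<iota>_mult)

text \<open>
  Division with remainder commutes with extending the field, so divisibility can be tested in the
  algebraic closure.
\<close>

lemma map_poly_\<iota>_dvd_iff:
  assumes "m \<noteq> 0"
  shows "map_poly \<iota> m dvd map_poly \<iota> f \<longleftrightarrow> m dvd f"
proof
  assume "map_poly \<iota> m dvd map_poly \<iota> f"
  moreover have "map_poly \<iota> f = map_poly \<iota> m * map_poly \<iota> (f div m) + map_poly \<iota> (f mod m)"
    by (simp flip: map_poly_\<iota>_mult map_poly_\<iota>_add)
  ultimately have dvd: "map_poly \<iota> m dvd map_poly \<iota> (f mod m)"
    by (simp add: dvd_add_right_iff)
  have "f mod m = 0"
  proof (rule ccontr)
    assume nz: "f mod m \<noteq> 0"
    then have "degree (map_poly \<iota> m) \<le> degree (map_poly \<iota> (f mod m))"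
      by (intro dvd_imp_degree_le dvd) (simp add: map_poly_eq_0_iff)
    with degree_mod_less'[OF assms nz] show False by (simp add: degree_map_poly)
  qed
  then show "m dvd f" by (simp add: dvd_eq_mod_eq_0)
next
  assume "m dvd f"
  then obtain k where "f = m * k" by (rule dvdE)
  then show "map_poly \<iota> m dvd map_poly \<iota> f" by (simp add: map_poly_\<iota>_mult)
qed

sublocale L: commutative_algebra "\<lambda>d x. \<iota> (to_fract d) * x"
  by unfold_locales (simp_all add: \<iota>_add \<iota>_mult algebra_simps)

lemma every_element_integral: "integral_element s"
  using finitely_generated finite_span_integral_element by (auto simp: finitely_generated_def)

lemma L_eval_poly: "L.eval_poly h x = poly (map_poly (\<lambda>d. \<iota> (to_fract d)) h) x"
  using L.poly_map_poly_scale[of h x] by simp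

text \<open>
  The field \<open>L\<close> is a \<open>D\<close>-algebra through \<open>\<iota>\<close>; this makes the results on integral elements of algebras
  available for the integral closure of \<open>D\<close> in \<open>L\<close>.
\<close>

lemma D_bar_iff: "x \<in> D_bar \<iota> \<longleftrightarrow> L.integral_element x"
proof -
  let ?j = "\<lambda>d. \<iota> (to_fract d)"
  have lead: "lead_coeff (map_poly ?j h) = 1 \<longleftrightarrow> lead_coeff h = 1" for h
  proof -
    have "?j c = 1 \<longleftrightarrow> c = 1" for c
    proof
      assume "?j c = 1"
      then have "\<iota> (to_fract (c - 1)) = 0"
        using \<iota>_add[of "to_fract (c - 1)" 1] by simp
      then show "c = 1" by (simp del: to_fract_diff)
    qed simp
    then show ?thesis by (simp add: degree_map_poly coeff_map_poly)
  qed
  have inj: "inj ?j"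
  proof (rule injI)
    fix c d assume "?j c = ?j d"
    then have "\<iota> (to_fract (c - d)) = 0"
      using \<iota>_add[of "to_fract (c - d)" "to_fract d"] by simp
    then show "c = d" by (simp del: to_fract_diff)
  qed
  show ?thesis
  proof
    assume "x \<in> D_bar \<iota>"
    then obtain p where p: "lead_coeff p = 1" "\<And>i. coeff p i \<in> range ?j" "poly p x = 0"
      by (auto simp: D_bar_def integral_closure_def integral_over_def)
    obtain h where "map_poly ?j h = p"
      using ex_map_poly_preimage[of ?j p] inj p(2) by auto
    with p lead[of h] show "L.integral_element x"
      unfolding L.integral_element_def L_eval_poly by blast
  next
    assume "L.integral_element x"
    then obtain h where "lead_coeff h = 1" "poly (map_poly ?j h) x = 0"
      by (auto simp: L.integral_element_def L_eval_poly)
    then show "x \<in> D_bar \<iota>"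
      unfolding D_bar_def integral_closure_def integral_over_def
      using lead[of h] by (auto simp: coeff_map_poly intro!: exI[of _ "map_poly ?j h"])
  qed
qed

abbreviation eval_L :: "'d fract poly \<Rightarrow> 'l \<Rightarrow> 'l" where
  "eval_L f \<alpha> \<equiv> poly (map_poly \<iota> f) \<alpha>"

lemma eval_L_pcompose: "eval_L (pcompose (fract_poly h) f) \<alpha> = L.eval_poly h (eval_L f \<alpha>)"
  by (induction h)
    (simp_all add: Polynomial.map_poly_pCons pcompose_pCons map_poly_\<iota>_add map_poly_\<iota>_mult)

lemma eval_L_fract_poly: "eval_L (fract_poly h) \<alpha> = L.eval_poly h \<alpha>"
  by (simp add: L_eval_poly map_poly_map_poly o_def)

lemma minimal_poly_nonzero: "minimal_poly scale s \<noteq> 0"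
  using minimal_poly_monic[OF every_element_integral[of s]] by auto

text \<open>
  The minimal polynomial divides any monic polynomial over \<open>D\<close> that vanishes at \<open>s\<close>, and so its roots
  are roots of the latter.
\<close>

lemma minimal_poly_root_in_D_bar:
  assumes "eval_L (minimal_poly scale s) \<alpha> = 0"
  shows "\<alpha> \<in> D_bar \<iota>"
proof -
  obtain h where h: "lead_coeff h = 1" "eval_poly h s = 0"
    using every_element_integral[of s] by (auto simp: integral_element_def)
  then have "minimal_poly scale s dvd fract_poly h"
    using value_at_fract_poly[of h s] value_at_0_iff_minimal_poly_dvd[OF every_element_integral[of s]] by simp
  then obtain k where "fract_poly h = minimal_poly scale s * k" by (rule dvdE)
  then have "eval_L (fract_poly h) \<alpha> = 0" by (simp add: map_poly_\<iota>_mult assms)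
  with h(1) show ?thesis
    unfolding D_bar_iff L.integral_element_def eval_L_fract_poly by blast
qed

lemma root_set_eq: "root_set scale \<iota> S = (\<Union>s\<in>S. {\<alpha>. eval_L (minimal_poly scale s) \<alpha> = 0})"
  using minimal_poly_root_in_D_bar by (auto simp: root_set_def)

lemma finite_root_set: "finite S \<Longrightarrow> finite (root_set scale \<iota> S)"
  unfolding root_set_eq
  by (intro finite_UN_I poly_roots_finite) (simp_all add: map_poly_eq_0_iff minimal_poly_nonzero)

lemma Int_alg_subset_Int_bar: "Int_alg scale S \<subseteq> Int_bar \<iota> (root_set scale \<iota> S)"
proof
  fix f assume f: "f \<in> Int_alg scale S"
  have "eval_L f \<alpha> \<in> D_bar \<iota>" if s: "s \<in> S" and root: "eval_L (minimal_poly scale s) \<alpha> = 0" for s \<alpha>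
  proof -
    obtain a where a: "value_at f s a" using f s by (auto simp: Int_alg_iff)
    obtain h where h: "lead_coeff h = 1" "eval_poly h a = 0"
      using every_element_integral[of a] by (auto simp: integral_element_def)
    have "minimal_poly scale s dvd pcompose (fract_poly h) f"
      using value_at_pcompose[OF a, of h] h(2)
        value_at_0_iff_minimal_poly_dvd[OF every_element_integral[of s]] by simp
    then obtain k where "pcompose (fract_poly h) f = minimal_poly scale s * k" by (rule dvdE)
    then have "L.eval_poly h (eval_L f \<alpha>) = 0"
      by (simp add: map_poly_\<iota>_mult root flip: eval_L_pcompose)
    with h(1) show ?thesis unfolding D_bar_iff L.integral_element_def by blast
  qed
  then show "f \<in> Int_bar \<iota> (root_set scale \<iota> S)" by (auto simp: Int_bar_def root_set_eq)
qed

lemma integral_over_Int_bar: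
  assumes "integral_over (to_fract ` Int_bar \<iota> \<Omega>) \<phi>"
  shows "\<phi> \<in> to_fract ` Int_bar \<iota> \<Omega>"
proof -
  obtain p where p: "lead_coeff p = 1" "\<And>i. coeff p i \<in> to_fract ` Int_bar \<iota> \<Omega>" "poly p \<phi> = 0"
    using assms by (auto simp: integral_over_def)
  have range: "coeff p i \<in> range to_fract" for i using p(2)[of i] by auto
  then have "integral_over (range to_fract) \<phi>" using p by (auto simp: integral_over_def)
  then obtain f where f: "\<phi> = to_fract f"
    using integral_over_field_poly_imp_poly by blast
  obtain P where P: "map_poly to_fract P = p"
    using ex_map_poly_preimage[of to_fract p] range by (auto simp: inj_def)
  have lead: "lead_coeff P = 1"
    using p(1) by (simp add: degree_map_poly coeff_map_poly flip: P to_fract_1)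
  have coeff: "coeff P i \<in> Int_bar \<iota> \<Omega>" for i
    using p(2)[of i] by (auto simp: coeff_map_poly simp flip: P)
  have "to_fract (poly P f) = 0"
    using p(3) poly_map_poly_hom[of to_fract P f] by (simp add: P f)
  then have root: "poly P f = 0" by simp
  have "eval_L f \<alpha> \<in> D_bar \<iota>" if "\<alpha> \<in> \<Omega>" for \<alpha>
  proof -
    let ?P = "map_poly (\<lambda>q. eval_L q \<alpha>) P"
    have "lead_coeff ?P = 1"
      using lead lead_coeff_map_poly_nz[of "\<lambda>q. eval_L q \<alpha>" P] by simp
    moreover have "L.integral_element (coeff ?P i)" for i
      using coeff[of i] that by (simp add: coeff_map_poly Int_bar_def flip: D_bar_iff)
    moreover have "poly ?P (eval_L f \<alpha>) = 0"
      using poly_map_poly_hom[of "\<lambda>q. eval_L q \<alpha>" P f] root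
      by (simp add: map_poly_\<iota>_add map_poly_\<iota>_mult)
    ultimately show ?thesis unfolding D_bar_iff by (rule L.integral_element_trans)
  qed
  then show ?thesis by (auto simp: f Int_bar_def)
qed

lemma Int_bar_integral_over_Int_alg:
  assumes "finite S" and f: "f \<in> Int_bar \<iota> (root_set scale \<iota> S)"
  shows "integral_over (to_fract ` Int_alg scale S) (to_fract f)"
proof -
  let ?\<Omega> = "root_set scale \<iota> S" and ?\<mu> = "minimal_poly scale"
  have "\<forall>\<alpha>\<in>?\<Omega>. \<exists>h. lead_coeff h = 1 \<and> L.eval_poly h (eval_L f \<alpha>) = 0"
    using f by (simp add: Int_bar_def D_bar_iff L.integral_element_def)
  then obtain h where h: "\<And>\<alpha>. \<alpha> \<in> ?\<Omega> \<Longrightarrow> lead_coeff (h \<alpha>) = 1"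
    "\<And>\<alpha>. \<alpha> \<in> ?\<Omega> \<Longrightarrow> L.eval_poly (h \<alpha>) (eval_L f \<alpha>) = 0"
    by metis
  define H where "H = (\<Prod>\<alpha>\<in>?\<Omega>. h \<alpha>)"
  have H_monic: "lead_coeff H = 1"
    by (simp add: H_def lead_coeff_prod h(1))
  have H_root: "L.eval_poly H (eval_L f \<alpha>) = 0" if "\<alpha> \<in> ?\<Omega>" for \<alpha>
    using that h(2)[OF that] finite_root_set[OF \<open>finite S\<close>]
    by (simp add: H_def prod.remove L.eval_poly_mult)
  \<comment> \<open>The sum of the degrees bounds the multiplicity of every root of every minimal polynomial.\<close>
  define N where "N = (\<Sum>s\<in>S. degree (?\<mu> s))"
  define Q where "Q = H ^ N"
  define G where "G = pcompose (fract_poly Q) f"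
  have G_eq: "G = pcompose (fract_poly H) f ^ N"
    unfolding G_def Q_def by (induction N) (simp_all add: pcompose_mult pcompose_1)
  have null: "value_at G s 0" if "s \<in> S" for s
  proof -
    have "map_poly \<iota> (?\<mu> s) dvd map_poly \<iota> (pcompose (fract_poly H) f) ^ degree (map_poly \<iota> (?\<mu> s))"
    proof (rule alg_closed_dvd_power_degree)
      show "map_poly \<iota> (?\<mu> s) \<noteq> 0" by (simp add: map_poly_eq_0_iff minimal_poly_nonzero)
      show "eval_L (pcompose (fract_poly H) f) \<alpha> = 0" if "eval_L (?\<mu> s) \<alpha> = 0" for \<alpha>
        using that \<open>s \<in> S\<close> H_root[of \<alpha>] by (auto simp: eval_L_pcompose root_set_eq)
    qed
    then have "?\<mu> s dvd pcompose (fract_poly H) f ^ degree (?\<mu> s)"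
      by (simp add: degree_map_poly map_poly_\<iota>_dvd_iff minimal_poly_nonzero flip: map_poly_\<iota>_power)
    also have "\<dots> dvd G"
      unfolding G_eq N_def using \<open>finite S\<close> that by (intro le_imp_power_dvd member_le_sum) auto
    finally show ?thesis
      by (simp add: value_at_0_iff_minimal_poly_dvd[OF every_element_integral])
  qed
  \<comment> \<open>The polynomial \<open>Y Q(Y) - f G\<close>. Without the factor \<open>Y\<close>, subtracting the constant term \<open>G\<close>
    from \<open>Q(Y)\<close> would spoil the leading coefficient if \<open>Q = 1\<close>, which happens for empty \<open>S\<close>.\<close>
  define P where "P = pCons (to_fract (G * - f)) (map_poly (\<lambda>d. to_fract [:to_fract d:]) Q)"
  have Q_monic: "lead_coeff Q = 1" by (simp add: Q_def lead_coeff_power H_monic)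
  then have "Q \<noteq> 0" by auto
  have "lead_coeff P = 1"
    using Q_monic \<open>Q \<noteq> 0\<close> by (simp add: P_def map_poly_eq_0_iff degree_map_poly coeff_map_poly one_pCons[symmetric])
  moreover have "coeff P i \<in> to_fract ` Int_alg scale S" for i
  proof (cases i)
    case 0
    have "G * - f \<in> Int_alg scale S"
      using value_at_0_mult[OF null, of _ "- f"] unfolding Int_alg_iff by blast
    moreover have "coeff P i = to_fract (G * - f)"
      unfolding P_def 0 coeff_pCons_0 ..
    ultimately show ?thesis by blast
  next
    case (Suc k)
    have "fract_poly [:coeff Q k:] \<in> Int_alg scale S"
      using value_at_fract_poly by (auto simp: Int_alg_iff)
    then show ?thesis
      by (auto simp: P_def Suc coeff_map_poly Polynomial.map_poly_pCons)
  qed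
  moreover have "poly P (to_fract f) = 0"
  proof -
    have "poly (map_poly (\<lambda>d. to_fract [:to_fract d:]) Q) (to_fract f) = to_fract G"
      unfolding G_def
      by (induction Q) (simp_all add: Polynomial.map_poly_pCons pcompose_pCons)
    then show ?thesis by (simp add: P_def mult.commute)
  qed
  ultimately show ?thesis unfolding integral_over_def by blast
qed

end

section \<open>The integral closure of the ring of integer-valued polynomials\<close>

theorem corollary1p5:
  fixes scale :: "'d::idom \<Rightarrow> 'a::ring_1 \<Rightarrow> 'a"
    and \<iota> :: "'d fract \<Rightarrow> 'l::alg_closed_field"
    and S :: "'a set"
  assumes "integrally_closed_domain TYPE('d)"
    and "\<exists>d::'d. d \<noteq> 0 \<and> \<not> d dvd 1"
    and "algebraic_closure_embedding \<iota>"
    and "associative_algebra scale"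
    and "torsion_free scale"
    and "finitely_generated scale"
    and "finite S"
  shows "quotient_field_of (to_fract ` Int_alg scale S) = (UNIV :: 'd fract poly fract set) \<and>
    integral_closure (to_fract ` Int_alg scale S) = to_fract ` Int_bar \<iota> (root_set scale \<iota> S)"
proof -
  interpret algebra_with_closure scale \<iota>
    using assms
    by (simp add: algebra_with_closure_def algebra_with_closure_axioms_def
        torsion_free_algebra_def torsion_free_algebra_axioms_def)
  have "\<phi> \<in> to_fract ` Int_bar \<iota> (root_set scale \<iota> S)"
    if "integral_over (to_fract ` Int_alg scale S) \<phi>" for \<phi>
  proof (rule integral_over_Int_bar)
    show "integral_over (to_fract ` Int_bar \<iota> (root_set scale \<iota> S)) \<phi>"
      using that Int_alg_subset_Int_bar[of S] unfolding integral_over_def by (meson image_mono subsetD)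
  qed
  then have "integral_closure (to_fract ` Int_alg scale S) = to_fract ` Int_bar \<iota> (root_set scale \<iota> S)"
    using Int_bar_integral_over_Int_alg[OF \<open>finite S\<close>] by (auto simp: integral_closure_def)
  then show ?thesis
    using quotient_field_Int_alg by simp
qed

end
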